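(* Let $G\cong H_n$. Then $$p(H_n)\le \max\{\,2p(H_{n-3}),\ p(H_{n-1})+1\,\}$$ for every $n\ge 4$.
   Context: All graphs are finite, simple and undirected. $K_r$ is the complete graph on $\{0,\dots,r-1\}$. For $m>1$ and integers $r_i>1$ ($1\le i\le m$), $H_m$ denotes the Hamming graph $H_m(r_1,\dots,r_m)=K_{r_1}\square\cdots\square K_{r_m}$ of dimension $m$, the Cartesian product of $m$ complete graphs: its vertices are the tuples $(x_1,\dots,x_m)$ with $0\le x_i\le r_i-1$, and two vertices are adjacent iff they differ in exactly one coordinate. $H_1$ denotes $K_r$ for some $r\ge 2$. A set $S\subseteq V(G)$ is $P_3$-convex if every vertex of $V(G)\setminus S$ has at most one neighbor in $S$. The $P_3$-hull $\mathcal H(S)$ of $S\subseteq V(G)$ is the smallest $P_3$-convex set of $G$ containing $S$. A minimal hull set of $G$ is a set $S\subseteq V(G)$ with $\mathcal H(S)=V(G)$ and $\mathcal H(R)\subsetneq V(G)$ for every proper subset $R$ of $S$. $p(G)$ denotes the maximum cardinality of a minimal hull set of $G$.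
   Formalization: H_{n-3} and H_{n-1} are taken as the products of the n-3 and n-1 largest complete factors of H_n; with H_m(r_1,...,r_m) for an arbitrary order of the r_i the inequality fails, e.g. for n=10 and r=(2,2,2,2,3,3,3,3,3,3). *)

theory Defs
  imports "Graph_Theory.Graph_Theory"
begin

text \<open>
  Graphs are represented by \<^typ>\<open>'a pair_pre_digraph\<close>: a finite simple undirected graph is a
  \<^locale>\<open>pair_graph\<close> (finite, loop-free, symmetric, no parallel arcs), an edge being
  given by its two orientations.
\<close>

definition P3_convex :: "'a pair_pre_digraph \<Rightarrow> 'a set \<Rightarrow> bool" where
  "P3_convex G S \<longleftrightarrow> S \<subseteq> pverts G \<and>
     (\<forall>v \<in> pverts G - S. card {u \<in> S. (v, u) \<in> parcs G} \<le> 1)"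

definition P3_hull :: "'a pair_pre_digraph \<Rightarrow> 'a set \<Rightarrow> 'a set" where
  "P3_hull G S = \<Inter> {C. P3_convex G C \<and> S \<subseteq> C}"

definition minimal_hull_set :: "'a pair_pre_digraph \<Rightarrow> 'a set \<Rightarrow> bool" where
  "minimal_hull_set G S \<longleftrightarrow> S \<subseteq> pverts G \<and> P3_hull G S = pverts G \<and>
     (\<forall>R. R \<subset> S \<longrightarrow> P3_hull G R \<subset> pverts G)"

definition p_num :: "'a pair_pre_digraph \<Rightarrow> nat" where
  "p_num G = Max {card S | S. minimal_hull_set G S}"

text \<open>
  The list \<open>[r\<^sub>1, \<dots>, r\<^sub>m]\<close> gives the orders of the complete factors; coordinates are indexed from
  0. For a one-element list this is \<open>K\<^sub>r\<close>, with vertices written as one-element lists.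
\<close>

definition hamming :: "nat list \<Rightarrow> nat list pair_pre_digraph" where
  "hamming rs =
     (let V = {x. length x = length rs \<and> (\<forall>i<length rs. x ! i < rs ! i)}
      in \<lparr> pverts = V,
           parcs = {(x, y). x \<in> V \<and> y \<in> V \<and> (\<exists>!i. i < length rs \<and> x ! i \<noteq> y ! i)} \<rparr>)"

text \<open>
  Reordering the factors does not change a Hamming graph up to isomorphism. With the factors of
  \<open>hamming rs\<close> listed as \<open>r\<^sub>1 \<ge> r\<^sub>2 \<ge> \<dots>\<close>, its lower-dimensional companion \<open>H\<^sub>m\<close> is
  \<open>H\<^sub>m(r\<^sub>1, \<dots>, r\<^sub>m)\<close>. The order matters: \<open>p\<close> is not a function of the dimension alone, and the
  inequality between \<open>H\<^sub>n\<close>, \<open>H\<^bsub>n-1\<^esub>\<close> and \<open>H\<^bsub>n-3\<^esub>\<close> can fail when larger factors are the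
  ones discarded.
\<close>

definition hamming_prefix :: "nat \<Rightarrow> nat list \<Rightarrow> nat list pair_pre_digraph" where
  "hamming_prefix m rs = hamming (take m (rev (sort rs)))"

lemma pair_graph_hamming: "pair_graph (hamming rs)"
proof -
  define V where "V = {x. length x = length rs \<and> (\<forall>i<length rs. x ! i < rs ! i)}"
  have eq: "hamming rs = \<lparr> pverts = V,
      parcs = {(x, y). x \<in> V \<and> y \<in> V \<and> (\<exists>!i. i < length rs \<and> x ! i \<noteq> y ! i)} \<rparr>"
    by (simp only: hamming_def V_def Let_def)
  have "V \<subseteq> {x. set x \<subseteq> {..Max (set rs)} \<and> length x = length rs}"
  proof
    fix x assume x: "x \<in> V"
    have "a \<le> Max (set rs)" if a: "a \<in> set x" for a
    proof -
      have len: "length x = length rs" using x by (simp add: V_def)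
      obtain i where "i < length x" "x ! i = a"
        using a by (auto simp: in_set_conv_nth)
      with len have i: "i < length rs" "a = x ! i" by simp_all
      then have "a < rs ! i" using x by (simp add: V_def)
      moreover have "rs ! i \<le> Max (set rs)" using i by simp
      ultimately show ?thesis by linarith
    qed
    then show "x \<in> {x. set x \<subseteq> {..Max (set rs)} \<and> length x = length rs}"
      using x by (auto simp: V_def)
  qed
  then have fin: "finite V"
    by (rule finite_subset) (rule finite_lists_length_eq, simp)
  have arcs: "parcs (hamming rs) \<subseteq> V \<times> V"
    unfolding eq by auto
  have verts: "pverts (hamming rs) = V" by (simp add: eq)
  show ?thesis
  proof
    show "fst e \<in> pverts (hamming rs)" "snd e \<in> pverts (hamming rs)"
      if "e \<in> parcs (hamming rs)" for e
      unfolding verts using subsetD[OF arcs that] by (simp_all add: mem_Times_iff)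
    show "finite (pverts (hamming rs))" unfolding verts by (rule fin)
    show "finite (parcs (hamming rs))" by (rule finite_subset[OF arcs]) (simp add: fin)
    show "fst e \<noteq> snd e" if "e \<in> parcs (hamming rs)" for e
      using that by (cases e) (auto simp add: eq simp del: split_paired_Ex)
    have "(y, x) \<in> parcs (hamming rs)" if "(x, y) \<in> parcs (hamming rs)" for x y
    proof -
      have "x \<in> V" "y \<in> V" and "\<exists>!i. i < length rs \<and> x ! i \<noteq> y ! i"
        using that by (simp_all add: eq)
      moreover from this(3) have "\<exists>!i. i < length rs \<and> y ! i \<noteq> x ! i" by metis
      ultimately show ?thesis by (simp add: eq)
    qed
    then show "symmetric (with_proj (hamming rs))"
      by (simp only: symmetric_def sym_def with_proj_simps) blast
  qed
qed

lemma P3_hull_least: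
  assumes "pair_graph G" and "S \<subseteq> pverts G"
  shows "P3_convex G (P3_hull G S)" and "S \<subseteq> P3_hull G S"
    and "P3_convex G C \<Longrightarrow> S \<subseteq> C \<Longrightarrow> P3_hull G S \<subseteq> C"
proof -
  interpret pair_graph G by fact
  have V: "P3_convex G (pverts G)" by (simp add: P3_convex_def)
  have fin: "finite (pverts G)" by (rule pair_finite_verts)
  show "P3_convex G (P3_hull G S)"
    unfolding P3_convex_def
  proof (intro conjI ballI)
    show "P3_hull G S \<subseteq> pverts G" using V assms(2) by (auto simp: P3_hull_def)
    fix v assume v: "v \<in> pverts G - P3_hull G S"
    then obtain D where D: "P3_convex G D" "S \<subseteq> D" "v \<notin> D" by (auto simp: P3_hull_def)
    have "P3_hull G S \<subseteq> D" using D by (auto simp: P3_hull_def)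
    moreover have "finite D" using D(1) fin by (auto simp: P3_convex_def intro: finite_subset)
    ultimately have "card {u \<in> P3_hull G S. (v, u) \<in> parcs G} \<le> card {u \<in> D. (v, u) \<in> parcs G}"
      by (intro card_mono) auto
    also have "\<dots> \<le> 1" using D v by (auto simp: P3_convex_def)
    finally show "card {u \<in> P3_hull G S. (v, u) \<in> parcs G} \<le> 1" .
  qed
  show "S \<subseteq> P3_hull G S" by (auto simp: P3_hull_def)
  show "P3_convex G C \<Longrightarrow> S \<subseteq> C \<Longrightarrow> P3_hull G S \<subseteq> C" by (auto simp: P3_hull_def)
qed

end

theory Submission
  imports Defs "HOL-Combinatorics.List_Permutation"
begin

text \<open>
  A subcube of a Hamming graph is obtained by fixing some coordinates. Two vertices at distance at
  most two generate the subcube that they span, while vertices further apart have no common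
  neighbour. Hence the \<open>P\<^sub>3\<close>-hull of a set is found by merging subcubes at distance at most two
  (\<open>cluster_cube_subset_convex\<close>) until the remaining ones are pairwise at distance at least three,
  when their union is convex (\<open>P3_convex_Union_maximal_boxes\<close>). So the sets whose hull is the
  whole graph are the clusters, the sets assembled from single vertices by such mergers, on which
  no coordinate is constant (\<open>hull_full_if_cluster\<close>, \<open>cluster_if_hull_full\<close>). Being a cluster
  depends only on which entries of the vertices coincide. This allows minimal spanning sets to be
  carried into Hamming graphs with more and larger factors, so the list of the \<open>m\<close> largest factors
  bounds all minimal spanning sets of subcubes of dimension at most \<open>m\<close>
  (\<open>minimal_cluster_card_le_prefix\<close>).

  Let \<open>S\<close> be a minimal hull set of an \<open>n\<close>-dimensional Hamming graph and let \<open>S = A \<union> B\<close> be its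
  last merger. Both parts are minimal for the subcubes that they span, because a smaller spanning
  set of one part could replace that part in \<open>S\<close> (\<open>subcluster_minimal\<close>). If both subcubes have
  dimension at most \<open>n - 3\<close>, then \<open>S\<close> has at most \<open>2 p(H\<^bsub>n-3\<^esub>)\<close> elements. Otherwise one of
  them, say that of \<open>A\<close>, fixes at most two coordinates, so every vertex is close enough to be
  merged with it. One or two vertices of \<open>S\<close>, each freeing a new coordinate, complete \<open>A\<close> to a set
  with full hull, and by minimality this set is \<open>S\<close>. Without the last added vertex it is still a
  cluster, spanning a proper subcube, so \<open>S\<close> has at most \<open>p(H\<^bsub>n-1\<^esub>) + 1\<close> elements
  (\<open>card_le_Suc_if_large_subcluster\<close>).
\<close>

section \<open>Minimal hull sets and isomorphism\<close>

lemma minimal_hull_set_exists: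
  assumes "finite U" "U \<subseteq> pverts G" "P3_hull G U = pverts G"
  obtains R where "R \<subseteq> U" "minimal_hull_set G R"
proof -
  let ?A = "{R. R \<subseteq> U \<and> P3_hull G R = pverts G}"
  have "finite ?A" by (rule finite_subset[of _ "Pow U"]) (use assms in auto)
  then obtain R where R: "R \<in> ?A" and min: "\<And>R'. R' \<in> ?A \<Longrightarrow> R' \<subseteq> R \<Longrightarrow> R = R'"
    using finite_has_minimal2[of ?A U] assms by auto
  have "P3_hull G R' \<subset> pverts G" if "R' \<subset> R" for R'
  proof -
    have "P3_hull G R' \<subseteq> pverts G"
      using that R assms(2) by (auto simp: P3_hull_def P3_convex_def)
    moreover have "P3_hull G R' \<noteq> pverts G"
      using min[of R'] that R by auto
    ultimately show ?thesis by blast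
  qed
  then have "minimal_hull_set G R"
    using R assms by (auto simp: minimal_hull_set_def)
  with R show ?thesis using that by auto
qed

lemma minimal_hull_set_proper_subset:
  "minimal_hull_set G S \<Longrightarrow> R \<subset> S \<Longrightarrow> P3_hull G R \<subset> pverts G"
  unfolding minimal_hull_set_def by (elim conjE allE[of _ R] impE; assumption)

lemma P3_hull_pverts: "P3_hull G (pverts G) = pverts G"
  by (auto simp: P3_hull_def P3_convex_def)

lemma finite_minimal_hull_cards:
  assumes "finite (pverts G)"
  shows "finite {card S | S. minimal_hull_set G S}"
  by (rule finite_subset[of _ "card ` Pow (pverts G)"])
     (use assms in \<open>auto simp: minimal_hull_set_def\<close>)

lemma card_le_p_num:
  assumes "finite (pverts G)" "minimal_hull_set G S"
  shows "card S \<le> p_num G"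
  unfolding p_num_def by (rule Max_ge) (use finite_minimal_hull_cards assms in auto)

lemma p_num_attained:
  assumes "finite (pverts G)"
  obtains S where "minimal_hull_set G S" "p_num G = card S"
proof -
  obtain R where "minimal_hull_set G R"
    using minimal_hull_set_exists[OF assms _ P3_hull_pverts] by blast
  then have "p_num G \<in> {card S | S. minimal_hull_set G S}"
    unfolding p_num_def by (intro Max_in finite_minimal_hull_cards assms) auto
  then show ?thesis using that by auto
qed

lemma P3_convex_image_iff:
  assumes inj: "inj_on f (pverts G)" and verts: "pverts H = f ` pverts G"
    and adj: "\<And>u v. u \<in> pverts G \<Longrightarrow> v \<in> pverts G \<Longrightarrow> (f u, f v) \<in> parcs H \<longleftrightarrow> (u, v) \<in> parcs G"
    and C: "C \<subseteq> pverts G"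
  shows "P3_convex H (f ` C) \<longleftrightarrow> P3_convex G C"
proof -
  have *: "card {w \<in> f ` C. (f v, w) \<in> parcs H} = card {u \<in> C. (v, u) \<in> parcs G}"
    if "v \<in> pverts G" for v
  proof -
    have "{w \<in> f ` C. (f v, w) \<in> parcs H} = f ` {u \<in> C. (v, u) \<in> parcs G}"
      using adj that C by (auto simp: subset_iff)
    moreover have "inj_on f {u \<in> C. (v, u) \<in> parcs G}"
      by (rule inj_on_subset[OF inj]) (use C in auto)
    ultimately show ?thesis by (simp add: card_image)
  qed
  have "pverts H - f ` C = f ` (pverts G - C)"
    unfolding verts using inj_on_image_set_diff[OF inj, of "pverts G" C] C by auto
  then show ?thesis using * C by (auto simp: P3_convex_def verts)
qed

lemma P3_hull_image:
  assumes inj: "inj_on f (pverts G)" and verts: "pverts H = f ` pverts G"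
    and adj: "\<And>u v. u \<in> pverts G \<Longrightarrow> v \<in> pverts G \<Longrightarrow> (f u, f v) \<in> parcs H \<longleftrightarrow> (u, v) \<in> parcs G"
    and S: "S \<subseteq> pverts G"
  shows "P3_hull H (f ` S) = f ` P3_hull G S"
proof (intro set_eqI iffI)
  have V: "P3_convex G (pverts G)" by (simp add: P3_convex_def)
  fix y
  {
    assume y: "y \<in> P3_hull H (f ` S)"
    have "y \<in> f ` C" if "P3_convex G C" "S \<subseteq> C" for C
      using y that P3_convex_image_iff[OF inj verts adj, of C]
      by (auto simp: P3_hull_def P3_convex_def)
    then have *: "\<And>C. P3_convex G C \<Longrightarrow> S \<subseteq> C \<Longrightarrow> y \<in> f ` C" .
    obtain x where x: "x \<in> pverts G" "y = f x" using *[OF V S] by auto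
    have "x \<in> C" if C: "P3_convex G C" "S \<subseteq> C" for C
      using *[OF C] x inj C(1) by (auto simp: P3_convex_def inj_on_def)
    then show "y \<in> f ` P3_hull G S" using x by (auto simp: P3_hull_def)
  }
  {
    assume "y \<in> f ` P3_hull G S"
    then obtain x where x: "x \<in> P3_hull G S" "y = f x" by auto
    have "y \<in> D" if D: "P3_convex H D" "f ` S \<subseteq> D" for D
    proof -
      let ?C = "{x \<in> pverts G. f x \<in> D}"
      have "f ` ?C = D" using D(1) verts by (auto simp: P3_convex_def)
      then have "P3_convex G ?C"
        using P3_convex_image_iff[OF inj verts adj, of ?C] D(1) by auto
      moreover have "S \<subseteq> ?C" using D(2) S by auto
      ultimately show ?thesis using x by (auto simp: P3_hull_def)
    qed
    then show "y \<in> P3_hull H (f ` S)" by (auto simp: P3_hull_def)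
  }
qed

lemma minimal_hull_set_image:
  assumes inj: "inj_on f (pverts G)" and verts: "pverts H = f ` pverts G"
    and adj: "\<And>u v. u \<in> pverts G \<Longrightarrow> v \<in> pverts G \<Longrightarrow> (f u, f v) \<in> parcs H \<longleftrightarrow> (u, v) \<in> parcs G"
    and S: "minimal_hull_set G S"
  shows "minimal_hull_set H (f ` S)"
  unfolding minimal_hull_set_def
proof (intro conjI allI impI)
  note hull = P3_hull_image[OF inj verts adj]
  have SV: "S \<subseteq> pverts G" and SH: "P3_hull G S = pverts G"
    using S by (auto simp: minimal_hull_set_def)
  show "f ` S \<subseteq> pverts H" using SV verts by auto
  show "P3_hull H (f ` S) = pverts H" using hull[OF _ _ SV] SH verts by simp
  fix R assume R: "R \<subset> f ` S"
  then obtain T where T: "T \<subseteq> S" "R = f ` T" by (auto dest!: psubset_imp_subset simp: subset_image_iff)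
  with R have "T \<subset> S" by auto
  then have lt: "P3_hull G T \<subset> pverts G" using S by (auto simp: minimal_hull_set_def)
  have "P3_hull H R = f ` P3_hull G T" using hull[of T] T SV by auto
  then show "P3_hull H R \<subset> pverts H"
    unfolding verts using inj lt inj_on_image_eq_iff[OF inj, of "P3_hull G T" "pverts G"] by auto
qed

lemma p_num_iso_le:
  assumes iso: "digraph_iso (with_proj G) (with_proj H)" and fin: "finite (pverts H)"
  shows "p_num G \<le> p_num H"
proof -
  obtain h where h: "pre_digraph.digraph_isomorphism (with_proj G) h"
    and H: "with_proj H = app_iso h (with_proj G)"
    using iso by (auto simp: digraph_iso_def)
  define f where "f = iso_verts h"
  have wf: "wf_digraph (with_proj G)" and inj: "inj_on f (pverts G)"
    and ends: "\<And>a. a \<in> parcs G \<Longrightarrow> f (fst a) = iso_tail h (iso_arcs h a) \<and> f (snd a) = iso_head h (iso_arcs h a)"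
    using h by (auto simp: pre_digraph.digraph_isomorphism_def f_def)
  have verts: "pverts H = f ` pverts G" and arcs: "parcs H = iso_arcs h ` parcs G"
    and tail: "iso_tail h = fst" and head: "iso_head h = snd"
    using H by (auto simp: app_iso_def with_proj_def f_def)
  have arc_image: "iso_arcs h a = (f (fst a), f (snd a))" if "a \<in> parcs G" for a
    using ends[OF that] tail head by (simp add: prod_eq_iff)
  have arc_verts: "fst a \<in> pverts G" "snd a \<in> pverts G" if "a \<in> parcs G" for a
    using wf_digraph.tail_in_verts[OF wf] wf_digraph.head_in_verts[OF wf] that by auto
  have adj: "(f u, f v) \<in> parcs H \<longleftrightarrow> (u, v) \<in> parcs G" if "u \<in> pverts G" "v \<in> pverts G" for u v
  proof
    assume "(f u, f v) \<in> parcs H"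
    then obtain a where a: "a \<in> parcs G" "(f u, f v) = iso_arcs h a" using arcs by auto
    then have "f u = f (fst a)" "f v = f (snd a)" using arc_image by auto
    then have "u = fst a" "v = snd a" using inj that arc_verts a(1) by (auto simp: inj_on_def)
    then show "(u, v) \<in> parcs G" using a by simp
  next
    assume "(u, v) \<in> parcs G"
    then show "(f u, f v) \<in> parcs H" using arc_image arcs by force
  qed
  have "finite (pverts G)" using fin inj unfolding verts by (rule finite_imageD)
  then obtain S where S: "minimal_hull_set G S" "p_num G = card S" by (rule p_num_attained)
  have "card (f ` S) = card S"
    by (rule card_image, rule inj_on_subset[OF inj]) (use S in \<open>auto simp: minimal_hull_set_def\<close>)
  moreover have "minimal_hull_set H (f ` S)"
    by (rule minimal_hull_set_image[OF inj verts adj S(1)])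
  ultimately show ?thesis using S(2) card_le_p_num[OF fin] by metis
qed

section \<open>Clusters\<close>

definition vary :: "nat \<Rightarrow> nat list set \<Rightarrow> nat set" where
  "vary n S = {i. i < n \<and> (\<exists>x\<in>S. \<exists>y\<in>S. x ! i \<noteq> y ! i)}"

text \<open>
  A cluster generates a single subcube by repeated merging of subcubes at distance at most two.
  The set \<open>vary n (S \<union> T) - vary n S - vary n T\<close> consists of the coordinates in which the
  subcubes spanned by \<open>S\<close> and \<open>T\<close> take different constant values, so its size is the distance
  of the two subcubes. Since it depends only on which entries are equal, clusters can be moved
  freely between Hamming graphs of different orders and dimensions. The two non-inclusion premises
  exclude trivial mergers, so that each inference really splits the cluster.
\<close>

inductive cluster :: "nat \<Rightarrow> nat list set \<Rightarrow> bool" for n where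
  single: "cluster n {x}"
| merge: "cluster n S \<Longrightarrow> cluster n T \<Longrightarrow> \<not> S \<subseteq> T \<Longrightarrow> \<not> T \<subseteq> S \<Longrightarrow>
    card (vary n (S \<union> T) - vary n S - vary n T) \<le> 2 \<Longrightarrow> cluster n (S \<union> T)"

lemma vary_less: "i \<in> vary n S \<Longrightarrow> i < n"
  by (simp add: vary_def)

lemma finite_vary [simp]: "finite (vary n S)"
  by (rule finite_subset[of _ "{..<n}"]) (auto simp: vary_def)

lemma vary_mono: "S \<subseteq> T \<Longrightarrow> vary n S \<subseteq> vary n T"
  by (auto simp: vary_def)

lemma vary_singleton [simp]: "vary n {x} = {}"
  by (simp add: vary_def)

lemma eq_if_not_vary: "i \<notin> vary n S \<Longrightarrow> i < n \<Longrightarrow> x \<in> S \<Longrightarrow> y \<in> S \<Longrightarrow> x ! i = y ! i"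
  unfolding vary_def by blast

text \<open>
  The coordinates that separate the spanned subcubes can be read off any two representatives.
\<close>

lemma distance_coordinates:
  assumes "x \<in> S" "y \<in> T"
  shows "vary n (S \<union> T) - vary n S - vary n T
    = {i. i < n \<and> i \<notin> vary n S \<and> i \<notin> vary n T \<and> x ! i \<noteq> y ! i}"
proof (intro set_eqI iffI)
  fix i assume i: "i \<in> vary n (S \<union> T) - vary n S - vary n T"
  then have n: "i < n" by (auto dest: vary_less)
  then have "\<forall>u\<in>S. u ! i = x ! i" "\<forall>u\<in>T. u ! i = y ! i"
    using assms i eq_if_not_vary by blast+
  moreover obtain u w where "u \<in> S \<union> T" "w \<in> S \<union> T" "u ! i \<noteq> w ! i"
    using i unfolding vary_def by blast
  ultimately have "x ! i \<noteq> y ! i" by auto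
  with i n show "i \<in> {i. i < n \<and> i \<notin> vary n S \<and> i \<notin> vary n T \<and> x ! i \<noteq> y ! i}" by simp
next
  fix i assume "i \<in> {i. i < n \<and> i \<notin> vary n S \<and> i \<notin> vary n T \<and> x ! i \<noteq> y ! i}"
  then show "i \<in> vary n (S \<union> T) - vary n S - vary n T"
    using assms unfolding vary_def by blast
qed

lemma cluster_Un:
  assumes "cluster n S" "cluster n T" "card (vary n (S \<union> T) - vary n S - vary n T) \<le> 2"
  shows "cluster n (S \<union> T)"
proof (cases "S \<subseteq> T \<or> T \<subseteq> S")
  case True
  then show ?thesis using assms by (auto simp: sup_absorb1 sup_absorb2)
next
  case False
  then show ?thesis using assms by (auto intro: merge)
qed

lemma cluster_insert:
  assumes "cluster n S" "card (vary n (insert x S) - vary n S) \<le> 2"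
  shows "cluster n (insert x S)"
  using cluster_Un[OF single[of n x] assms(1)] assms(2) by simp

lemma cluster_finite_nonempty: "cluster n S \<Longrightarrow> finite S \<and> S \<noteq> {}"
  by (induction rule: cluster.induct) auto

section \<open>Hulls in Hamming graphs\<close>

lemma pverts_hamming:
  "pverts (hamming rs) = {x. length x = length rs \<and> (\<forall>i<length rs. x ! i < rs ! i)}"
  by (simp add: hamming_def Let_def)

lemma finite_pverts_hamming: "finite (pverts (hamming rs))"
proof -
  interpret pair_graph "hamming rs" by (rule pair_graph_hamming)
  show ?thesis by (rule pair_finite_verts)
qed

lemma parcs_hamming_iff:
  "(x, y) \<in> parcs (hamming rs) \<longleftrightarrow> x \<in> pverts (hamming rs) \<and> y \<in> pverts (hamming rs) \<and>
     (\<exists>!i. i < length rs \<and> x ! i \<noteq> y ! i)"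
  by (simp add: hamming_def Let_def)

lemma hamming_adjacent_update:
  assumes "v \<in> pverts (hamming rs)" "i < length rs" "c < rs ! i" "c \<noteq> v ! i"
  shows "(v, v[i := c]) \<in> parcs (hamming rs)"
proof -
  have "v[i := c] \<in> pverts (hamming rs)"
    using assms by (auto simp: pverts_hamming nth_list_update)
  moreover have "\<exists>!j. j < length rs \<and> v ! j \<noteq> v[i := c] ! j"
    using assms by (intro ex1I[of _ i]) (auto simp: pverts_hamming nth_list_update split: if_splits)
  ultimately show ?thesis using assms(1) by (simp add: parcs_hamming_iff)
qed

lemma P3_convex_two_neighbours:
  assumes C: "P3_convex G C" and "finite (pverts G)" and v: "v \<in> pverts G"
    and u: "u \<in> C" "(v, u) \<in> parcs G" and w: "w \<in> C" "(v, w) \<in> parcs G" and "u \<noteq> w"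
  shows "v \<in> C"
proof (rule ccontr)
  assume "v \<notin> C"
  then have "card {u \<in> C. (v, u) \<in> parcs G} \<le> 1" using C v by (auto simp: P3_convex_def)
  moreover have "finite C" using C assms(2) by (auto simp: P3_convex_def intro: finite_subset)
  then have "card {u, w} \<le> card {u \<in> C. (v, u) \<in> parcs G}"
    by (intro card_mono) (use u w in auto)
  ultimately show False using \<open>u \<noteq> w\<close> by simp
qed

definition cube :: "nat list \<Rightarrow> nat list \<Rightarrow> nat set \<Rightarrow> nat list set" where
  "cube rs a P = {v \<in> pverts (hamming rs). \<forall>i<length rs. i \<notin> P \<longrightarrow> v ! i = a ! i}"

lemma cube_rebase: "b \<in> cube rs a P \<Longrightarrow> cube rs b P = cube rs a P"
  by (auto simp: cube_def)

lemma convex_two_updates: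
  assumes C: "P3_convex (hamming rs) C" and v: "v \<in> pverts (hamming rs)"
    and i: "i < length rs" "c < rs ! i" "c \<noteq> v ! i" "v[i := c] \<in> C"
    and j: "j < length rs" "d < rs ! j" "d \<noteq> v ! j" "v[j := d] \<in> C"
    and ne: "i \<noteq> j \<or> c \<noteq> d"
  shows "v \<in> C"
proof (rule P3_convex_two_neighbours[OF C finite_pverts_hamming v])
  show "v[i := c] \<in> C" "v[j := d] \<in> C" by fact+
  show "(v, v[i := c]) \<in> parcs (hamming rs)" "(v, v[j := d]) \<in> parcs (hamming rs)"
    using hamming_adjacent_update v i j by auto
  have len: "length v = length rs" using v by (simp add: pverts_hamming)
  have "v[i := c] ! i \<noteq> v[j := d] ! i"
    using ne i j len by (auto simp: nth_list_update)
  then show "v[i := c] \<noteq> v[j := d]" by auto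
qed

text \<open>
  A vertex of the joint cube outside both given cubes differs from \<open>c\<close> in a coordinate outside
  \<open>P\<close> and in another one outside \<open>Q\<close>. Resetting either of them gives a neighbour closer to \<open>c\<close>,
  so induction on the distance to \<open>c\<close> provides two neighbours in \<open>C\<close>.
\<close>

lemma cube_Un_subset_convex:
  assumes C: "P3_convex (hamming rs) C" and c: "c \<in> pverts (hamming rs)"
    and P: "cube rs c P \<subseteq> C" and Q: "cube rs c Q \<subseteq> C"
  shows "cube rs c (P \<union> Q) \<subseteq> C"
proof
  fix v assume "v \<in> cube rs c (P \<union> Q)"
  then show "v \<in> C"
  proof (induction "card {i. i < length rs \<and> v ! i \<noteq> c ! i}" arbitrary: v rule: less_induct)
    case less
    have len: "length v = length rs" using less(2) by (simp add: cube_def pverts_hamming)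
    have step: "v[i := c ! i] \<in> C" if i: "i < length rs" "v ! i \<noteq> c ! i" for i
    proof (rule less(1))
      show "v[i := c ! i] \<in> cube rs c (P \<union> Q)"
        using less(2) c i len by (auto simp: cube_def pverts_hamming nth_list_update)
      show "card {j. j < length rs \<and> v[i := c ! i] ! j \<noteq> c ! j} < card {j. j < length rs \<and> v ! j \<noteq> c ! j}"
        by (rule psubset_card_mono) (use i len in \<open>auto simp: nth_list_update\<close>)
    qed
    show ?case
    proof (cases "v \<in> cube rs c P \<or> v \<in> cube rs c Q")
      case True
      then show ?thesis using P Q by auto
    next
      case False
      then obtain i j where i: "i < length rs" "i \<notin> P" "v ! i \<noteq> c ! i"
        and j: "j < length rs" "j \<notin> Q" "v ! j \<noteq> c ! j"
        using less(2) by (auto simp: cube_def)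
      have "i \<noteq> j" using i j less(2) by (auto simp: cube_def)
      then show ?thesis
        using convex_two_updates[OF C, of v i "c ! i" j "c ! j"] i j step c less(2)
        by (auto simp: cube_def pverts_hamming)
    qed
  qed
qed

lemma line_subset_convex:
  assumes C: "P3_convex (hamming rs) C" and a: "a \<in> C" and b: "b \<in> C"
    and diff: "{i. i < length rs \<and> a ! i \<noteq> b ! i} \<subseteq> {g}" and ne: "a \<noteq> b"
  shows "cube rs a {g} \<subseteq> C"
proof
  fix v assume v: "v \<in> cube rs a {g}"
  have aV: "a \<in> pverts (hamming rs)" and bV: "b \<in> pverts (hamming rs)"
    using C a b by (auto simp: P3_convex_def)
  have vV: "v \<in> pverts (hamming rs)" using v by (simp add: cube_def)
  have len: "length a = length rs" "length b = length rs" "length v = length rs"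
    using aV bV vV by (auto simp: pverts_hamming)
  have g: "g < length rs" "a ! g \<noteq> b ! g"
    using ne len diff by (auto simp: list_eq_iff_nth_eq)
  have upd: "v[g := a ! g] = a" "v[g := b ! g] = b"
    using v diff len g by (auto simp: cube_def list_eq_iff_nth_eq nth_list_update)
  show "v \<in> C"
  proof (cases "v ! g = a ! g \<or> v ! g = b ! g")
    case True
    then show ?thesis using upd a b by (metis list_update_id)
  next
    case False
    then show ?thesis
      using convex_two_updates[OF C vV g(1) _ _ _ g(1), of "a ! g" "b ! g"] upd a b g aV bV
      by (auto simp: pverts_hamming)
  qed
qed

text \<open>
  At distance two a common neighbour \<open>c\<close> of \<open>a\<close> and \<open>b\<close> belongs to \<open>C\<close>, hence so do the lines
  through \<open>c\<close> and \<open>a\<close> and through \<open>c\<close> and \<open>b\<close>, and they span the required plane.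
\<close>

lemma cube_of_two_points_subset_convex:
  assumes C: "P3_convex (hamming rs) C" and a: "a \<in> C" and b: "b \<in> C"
    and card: "card {i. i < length rs \<and> a ! i \<noteq> b ! i} \<le> 2"
  shows "cube rs a {i. i < length rs \<and> a ! i \<noteq> b ! i} \<subseteq> C" (is "cube rs a ?G \<subseteq> C")
proof -
  have aV: "a \<in> pverts (hamming rs)" and bV: "b \<in> pverts (hamming rs)"
    using C a b by (auto simp: P3_convex_def)
  have len: "length a = length rs" "length b = length rs"
    using aV bV by (auto simp: pverts_hamming)
  consider "?G = {}" | g where "?G = {g}" | g h where "?G = {g, h}" "g \<noteq> h"
  proof -
    have "finite ?G" by simp
    moreover have "card ?G = 0 \<or> card ?G = 1 \<or> card ?G = 2" using card by linarith
    ultimately have "?G = {} \<or> (\<exists>g. ?G = {g}) \<or> (\<exists>g h. ?G = {g, h} \<and> g \<noteq> h)"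
      by (auto simp only: card_0_eq card_1_singleton_iff card_2_iff One_nat_def)
    then show ?thesis using that by blast
  qed
  then show ?thesis
  proof cases
    case 1
    have "cube rs a ?G = {a}"
      using aV len unfolding 1 by (auto simp: cube_def pverts_hamming list_eq_iff_nth_eq)
    then show ?thesis using a by simp
  next
    case (2 g)
    then have "a \<noteq> b" by auto
    then show ?thesis using line_subset_convex[OF C a b, of g] 2 by simp
  next
    case (3 g h)
    have g: "g < length rs" "a ! g \<noteq> b ! g" and h: "h < length rs" "a ! h \<noteq> b ! h"
      using 3 by auto
    have other: "a ! i = b ! i" if "i < length rs" "i \<noteq> g" "i \<noteq> h" for i
      using 3 that by blast
    define c where "c = a[g := b ! g]"
    have cV: "c \<in> pverts (hamming rs)"
      using aV bV g by (auto simp: c_def pverts_hamming nth_list_update)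
    have c': "c[g := a ! g] = a" "c[h := b ! h] = b" "c ! g = b ! g" "c ! h = a ! h"
      using g h 3 len other by (auto simp: c_def list_eq_iff_nth_eq nth_list_update)
    have cC: "c \<in> C"
      using convex_two_updates[OF C cV, of g "a ! g" h "b ! h"] c' g h a b 3 aV bV
      by (auto simp: pverts_hamming)
    have "c \<noteq> a" "c \<noteq> b" using c' g h by auto
    have "cube rs c {g} \<subseteq> C"
      by (rule line_subset_convex[OF C cC a]) (use \<open>c \<noteq> a\<close> g len in \<open>auto simp: c_def nth_list_update split: if_splits\<close>)
    moreover have "cube rs c {h} \<subseteq> C"
      by (rule line_subset_convex[OF C cC b]) (use \<open>c \<noteq> b\<close> g len other in \<open>auto simp: c_def nth_list_update split: if_splits\<close>)
    ultimately have "cube rs c ({g} \<union> {h}) \<subseteq> C"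
      by (rule cube_Un_subset_convex[OF C cV])
    moreover have "c \<in> cube rs a {g, h}"
      using cV g by (auto simp: cube_def c_def nth_list_update)
    ultimately show ?thesis using cube_rebase[of c rs a "{g, h}"] 3 by (simp add: insert_commute)
  qed
qed

text \<open>
  The cube spanned by a closest pair of vertices bridges the two subcubes: it meets each of them,
  so both can be joined to it in turn.
\<close>

lemma cube_merge_subset_convex:
  assumes C: "P3_convex (hamming rs) C"
    and s: "s \<in> pverts (hamming rs)" and t: "t \<in> pverts (hamming rs)"
    and P: "cube rs s P \<subseteq> C" and Q: "cube rs t Q \<subseteq> C"
    and G: "G = {i. i < length rs \<and> i \<notin> P \<and> i \<notin> Q \<and> s ! i \<noteq> t ! i}" "card G \<le> 2"
  shows "cube rs s (P \<union> Q \<union> G) \<subseteq> C"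
proof -
  \<comment> \<open>\<open>a\<close> and \<open>b\<close> are closest points of the two subcubes: they differ exactly in \<open>G\<close>.\<close>
  define a where "a = map (\<lambda>i. if i \<in> P - Q then t ! i else s ! i) [0..<length rs]"
  define b where "b = map (\<lambda>i. if i \<in> Q then s ! i else t ! i) [0..<length rs]"
  have V: "a \<in> pverts (hamming rs)" "b \<in> pverts (hamming rs)"
    using s t by (auto simp: a_def b_def pverts_hamming)
  have aP: "a \<in> cube rs s P" and bQ: "b \<in> cube rs t Q"
    using V by (auto simp: cube_def a_def b_def)
  have diff: "{i. i < length rs \<and> a ! i \<noteq> b ! i} = G"
    unfolding G by (auto simp: a_def b_def split: if_splits)
  have "cube rs a G \<subseteq> C"
    using cube_of_two_points_subset_convex[OF C, of a b] aP bQ P Q G diff by auto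
  then have *: "cube rs a (P \<union> G) \<subseteq> C"
    using cube_Un_subset_convex[OF C V(1), of P G] cube_rebase[OF aP] P by simp
  have "b \<in> cube rs a (P \<union> G)"
    using V diff by (auto simp: cube_def)
  then have "cube rs b (P \<union> G) \<subseteq> C" using * cube_rebase by simp
  then have "cube rs b (P \<union> G \<union> Q) \<subseteq> C"
    using cube_Un_subset_convex[OF C V(2)] cube_rebase[OF bQ] Q by simp
  moreover have "b \<in> cube rs s (P \<union> G \<union> Q)"
    using V G by (auto simp: cube_def b_def)
  ultimately show ?thesis using cube_rebase by (metis sup.assoc sup.commute)
qed

text \<open>
  Each merger of a cluster stays inside \<open>C\<close>, because it joins two subcubes of \<open>C\<close> at distance at
  most two.
\<close>

lemma cluster_cube_subset_convex:
  assumes "cluster (length rs) S" "S \<subseteq> C" "P3_convex (hamming rs) C" "s \<in> S"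
  shows "cube rs s (vary (length rs) S) \<subseteq> C"
  using assms
proof (induction arbitrary: s rule: cluster.induct)
  case (single x)
  have "cube rs x {} \<subseteq> {x}" if "x \<in> pverts (hamming rs)"
    using that by (auto simp: cube_def pverts_hamming list_eq_iff_nth_eq)
  then show ?case using single by (auto simp: P3_convex_def)
next
  case (merge S T)
  let ?n = "length rs"
  have V: "S \<union> T \<subseteq> pverts (hamming rs)" using merge by (auto simp: P3_convex_def)
  obtain x y where x: "x \<in> S" and y: "y \<in> T" using merge by auto
  let ?G = "{i. i < ?n \<and> i \<notin> vary ?n S \<and> i \<notin> vary ?n T \<and> x ! i \<noteq> y ! i}"
  have G: "?G = vary ?n (S \<union> T) - vary ?n S - vary ?n T"
    using distance_coordinates[OF x y, of ?n] by auto
  then have U: "vary ?n S \<union> vary ?n T \<union> ?G = vary ?n (S \<union> T)"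
    using vary_mono[of S "S \<union> T" ?n] vary_mono[of T "S \<union> T" ?n] by auto
  have "cube rs x (vary ?n S \<union> vary ?n T \<union> ?G) \<subseteq> C"
  proof (rule cube_merge_subset_convex)
    show "P3_convex (hamming rs) C" by fact
    show "x \<in> pverts (hamming rs)" "y \<in> pverts (hamming rs)" using x y V by auto
    show "cube rs x (vary ?n S) \<subseteq> C" "cube rs y (vary ?n T) \<subseteq> C"
      using merge x y by auto
    show "card ?G \<le> 2" unfolding G using merge by simp
  qed simp
  moreover have "s \<in> cube rs x (vary ?n (S \<union> T))"
    using merge.prems V x eq_if_not_vary[of _ ?n "S \<union> T" s x] by (auto simp: cube_def)
  ultimately show ?case unfolding U using cube_rebase by simp
qed

text \<open>
  The subcube spanned by \<open>S\<close>, described without choosing a base point in \<open>S\<close>.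
\<close>

definition box :: "nat list \<Rightarrow> nat list set \<Rightarrow> nat list set" where
  "box rs S = {v \<in> pverts (hamming rs).
     \<forall>i<length rs. i \<notin> vary (length rs) S \<longrightarrow> (\<forall>x\<in>S. v ! i = x ! i)}"

lemma subset_box:
  assumes "S \<subseteq> pverts (hamming rs)"
  shows "S \<subseteq> box rs S"
proof
  fix x assume "x \<in> S"
  then show "x \<in> box rs S"
    using assms eq_if_not_vary[of _ "length rs" S x] by (auto simp: box_def)
qed

lemma boxes_apart:
  assumes "u \<in> box rs P" "w \<in> box rs Q" "P \<noteq> {}" "Q \<noteq> {}"
  shows "vary (length rs) (P \<union> Q) - vary (length rs) P - vary (length rs) Q
    \<subseteq> {i. i < length rs \<and> u ! i \<noteq> w ! i}"
proof -
  obtain x y where x: "x \<in> P" and y: "y \<in> Q" using assms(3,4) by auto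
  then show ?thesis
    unfolding distance_coordinates[OF x y] using assms(1,2) by (auto simp: box_def)
qed

lemma cluster_Un_of_close_points:
  assumes "cluster (length rs) P" "cluster (length rs) Q" "u \<in> box rs P" "w \<in> box rs Q"
    and "{i. i < length rs \<and> u ! i \<noteq> w ! i} \<subseteq> {j, k}"
  shows "cluster (length rs) (P \<union> Q)"
proof (rule cluster_Un[OF assms(1,2)])
  have "P \<noteq> {}" "Q \<noteq> {}" using assms(1,2) cluster_finite_nonempty by auto
  have "card (vary (length rs) (P \<union> Q) - vary (length rs) P - vary (length rs) Q) \<le> card {j, k}"
    by (rule card_mono) (use boxes_apart[OF assms(3,4) \<open>P \<noteq> {}\<close> \<open>Q \<noteq> {}\<close>] assms(5) in auto)
  also have "\<dots> \<le> 2" by (simp add: card_insert_if)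
  finally show "card (vary (length rs) (P \<union> Q) - vary (length rs) P - vary (length rs) Q) \<le> 2" .
qed

text \<open>
  If no two of the clusters can be merged, their subcubes are pairwise at distance at least three.
  Two neighbours of a vertex differ in at most two coordinates, so if both lie in the union they lie
  in the same subcube, which is itself convex.
\<close>

lemma P3_convex_Union_maximal_boxes:
  assumes clusters: "\<And>P. P \<in> M \<Longrightarrow> cluster (length rs) P"
    and apart: "\<And>P Q. P \<in> M \<Longrightarrow> Q \<in> M \<Longrightarrow> cluster (length rs) (P \<union> Q) \<Longrightarrow> P = Q"
  shows "P3_convex (hamming rs) (\<Union>P\<in>M. box rs P)" (is "P3_convex _ ?U")
  unfolding P3_convex_def
proof (intro conjI ballI)
  show "?U \<subseteq> pverts (hamming rs)" by (auto simp: box_def)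
  fix v assume v: "v \<in> pverts (hamming rs) - ?U"
  have "u = w" if u: "u \<in> ?U" "(v, u) \<in> parcs (hamming rs)"
    and w: "w \<in> ?U" "(v, w) \<in> parcs (hamming rs)" for u w
  proof -
    obtain j where j: "j < length rs" "v ! j \<noteq> u ! j" "\<And>i. i < length rs \<Longrightarrow> i \<noteq> j \<Longrightarrow> v ! i = u ! i"
      using u(2) unfolding parcs_hamming_iff by metis
    obtain k where k: "k < length rs" "v ! k \<noteq> w ! k" "\<And>i. i < length rs \<Longrightarrow> i \<noteq> k \<Longrightarrow> v ! i = w ! i"
      using w(2) unfolding parcs_hamming_iff by metis
    obtain P Q where P: "P \<in> M" "u \<in> box rs P" and Q: "Q \<in> M" "w \<in> box rs Q"
      using u w by auto
    have "{i. i < length rs \<and> u ! i \<noteq> w ! i} \<subseteq> {j, k}" using j(3) k(3) by (metis (mono_tags, lifting) insert_iff mem_Collect_eq subsetI)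
    then have "P = Q"
      using cluster_Un_of_close_points apart clusters P Q by blast
    have "v \<notin> box rs P" using v P by auto
    then obtain i x where i: "i < length rs" "i \<notin> vary (length rs) P" "x \<in> P" "v ! i \<noteq> x ! i"
      using v by (auto simp: box_def)
    then have "u ! i = x ! i" "w ! i = x ! i" using P Q \<open>P = Q\<close> by (auto simp: box_def)
    then have "i = j" "i = k" "u ! i = w ! i" using i j k by metis+
    then have "u ! l = w ! l" if "l < length rs" for l using that j k by metis
    then show ?thesis using u w by (auto simp: parcs_hamming_iff pverts_hamming list_eq_iff_nth_eq)
  qed
  then show "card {u \<in> ?U. (v, u) \<in> parcs (hamming rs)} \<le> 1"
    by (simp add: card_le_Suc0_iff_eq[OF finite_subset[OF _ finite_pverts_hamming[of rs]]] box_def subset_iff)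
qed

lemma hull_full_if_cluster:
  assumes S: "S \<subseteq> pverts (hamming rs)" and "cluster (length rs) S" "vary (length rs) S = {..<length rs}"
  shows "P3_hull (hamming rs) S = pverts (hamming rs)"
proof
  note hull = P3_hull_least[OF pair_graph_hamming S]
  show "P3_hull (hamming rs) S \<subseteq> pverts (hamming rs)"
    using hull(1) by (auto simp: P3_convex_def)
  obtain s where s: "s \<in> S" using assms cluster_finite_nonempty by blast
  have "cube rs s (vary (length rs) S) \<subseteq> P3_hull (hamming rs) S"
    by (rule cluster_cube_subset_convex) (use assms hull s in auto)
  then show "pverts (hamming rs) \<subseteq> P3_hull (hamming rs) S"
    using assms(3) by (auto simp: cube_def)
qed

text \<open>
  The subcubes of the maximal clusters in \<open>S\<close> form a convex set, so they cover the graph. A maximal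
  cluster cannot be constant in a coordinate: changing that coordinate would lead to an adjacent
  subcube of the cover, with which it could be merged. Hence there is only one maximal cluster.
\<close>

lemma cluster_if_hull_full:
  assumes S: "S \<subseteq> pverts (hamming rs)" and full: "P3_hull (hamming rs) S = pverts (hamming rs)"
    and rs: "\<forall>r\<in>set rs. r > 1"
  shows "cluster (length rs) S" "vary (length rs) S = {..<length rs}"
proof -
  let ?n = "length rs" and ?V = "pverts (hamming rs)"
  have fin: "finite S" using S finite_pverts_hamming finite_subset by blast
  define A where "A = {P. P \<subseteq> S \<and> cluster ?n P}"
  define M where "M = {P \<in> A. \<forall>Q\<in>A. P \<subseteq> Q \<longrightarrow> P = Q}"
  have finA: "finite A" using fin by (auto simp: A_def intro: finite_subset[of _ "Pow S"])
  have cover: "\<exists>P\<in>M. s \<in> P" if "s \<in> S" for s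
  proof -
    have "{s} \<in> A" using that by (auto simp: A_def intro: single)
    then show ?thesis
      using finite_has_maximal2[OF finA, of "{s}"] by (auto simp: M_def)
  qed
  have clusters: "cluster ?n P" if "P \<in> M" for P using that by (auto simp: M_def A_def)
  have maximal: "P = X" if "P \<in> M" "X \<in> A" "P \<subseteq> X" for P X
    using that by (simp add: M_def)
  have apart: "P = Q" if "P \<in> M" "Q \<in> M" "cluster ?n (P \<union> Q)" for P Q
  proof -
    have "P \<union> Q \<in> A" using that by (auto simp: M_def A_def)
    then have "P = P \<union> Q" "Q = P \<union> Q"
      using maximal[OF that(1) _ Un_upper1] maximal[OF that(2) _ Un_upper2] by simp_all
    then show ?thesis by (rule trans[OF _ sym])
  qed
  have MS: "P \<subseteq> S" if "P \<in> M" for P using that by (auto simp: M_def A_def)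
  have "P3_convex (hamming rs) (\<Union>P\<in>M. box rs P)"
    by (rule P3_convex_Union_maximal_boxes[OF clusters apart])
  moreover have "S \<subseteq> (\<Union>P\<in>M. box rs P)"
  proof
    fix s assume "s \<in> S"
    then obtain P where P: "P \<in> M" "s \<in> P" using cover by auto
    then show "s \<in> (\<Union>P\<in>M. box rs P)" using subset_box[of P rs] MS[of P] S by auto
  qed
  ultimately have all: "?V \<subseteq> (\<Union>P\<in>M. box rs P)"
    using full unfolding P3_hull_def by blast
  have rs_gt: "1 < rs ! i" if "i < ?n" for i using rs that by simp
  have zero: "replicate ?n 0 \<in> ?V"
    using rs_gt by (auto simp: pverts_hamming) (metis less_trans zero_less_one One_nat_def)
  then obtain P where P: "P \<in> M" using all by blast
  then have PS: "P \<subseteq> S" and "P \<noteq> {}" using MS[OF P] cluster_finite_nonempty[OF clusters[OF P]] by auto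
  then obtain x where x: "x \<in> P" by auto
  have xV: "x \<in> ?V" and xP: "x \<in> box rs P"
    using x PS S subset_box[of P rs] by auto
  have vary: "vary ?n P = {..<?n}"
  proof (rule ccontr)
    assume "vary ?n P \<noteq> {..<?n}"
    then obtain i where i: "i < ?n" "i \<notin> vary ?n P" by (auto dest: vary_less)
    define c where "c = (if x ! i = 0 then 1 else 0 :: nat)"
    have c: "c < rs ! i" "c \<noteq> x ! i" using rs_gt[OF i(1)] by (auto simp: c_def)
    let ?y = "x[i := c]"
    have y: "?y \<in> ?V" using xV c i by (auto simp: pverts_hamming nth_list_update)
    then obtain Q where Q: "Q \<in> M" "?y \<in> box rs Q" using all by blast
    have "{j. j < ?n \<and> x ! j \<noteq> ?y ! j} \<subseteq> {i, i}" by auto (metis nth_list_update_neq)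
    then have "cluster ?n (P \<union> Q)"
      by (rule cluster_Un_of_close_points[OF clusters[OF P] clusters[OF Q(1)] xP Q(2)])
    then have "P = Q" by (rule apart[OF P Q(1)])
    then have "?y ! i = x ! i" using Q(2) i x unfolding box_def by blast
    then show False using c i xV by (simp add: pverts_hamming)
  qed
  have "S \<subseteq> P"
  proof
    fix s assume "s \<in> S"
    then obtain Q where Q: "Q \<in> M" "s \<in> Q" using cover by auto
    have "cluster ?n (P \<union> Q)"
    proof (rule cluster_Un[OF clusters[OF P] clusters[OF Q(1)]])
      have "vary ?n (P \<union> Q) - vary ?n P - vary ?n Q = {}" using vary by (auto dest: vary_less)
      then have "card (vary ?n (P \<union> Q) - vary ?n P - vary ?n Q) = 0" by (simp only: card.empty)
      then show "card (vary ?n (P \<union> Q) - vary ?n P - vary ?n Q) \<le> 2" by linarith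
    qed
    then show "s \<in> P" using apart P Q by auto
  qed
  then have "P = S" using PS by auto
  then show "cluster ?n S" "vary ?n S = {..<?n}" using clusters P vary by auto
qed

section \<open>Moving clusters between Hamming graphs\<close>

text \<open>
  Coordinates in \<open>D\<close> are read from \<open>y\<close> along \<open>\<phi>\<close>, the others are copied from a fixed \<open>t\<close>. Maps of
  this form include the embedding of a subcube into another Hamming graph as well as the
  projection back onto the subcube.
\<close>

definition recoordinate ::
    "nat \<Rightarrow> nat set \<Rightarrow> (nat \<Rightarrow> nat) \<Rightarrow> nat list \<Rightarrow> nat list \<Rightarrow> nat list" where
  "recoordinate n D \<phi> t y = map (\<lambda>i. if i \<in> D then y ! \<phi> i else t ! i) [0..<n]"

lemma length_recoordinate [simp]: "length (recoordinate n D \<phi> t y) = n"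
  by (simp add: recoordinate_def)

lemma nth_recoordinate:
  "i < n \<Longrightarrow> recoordinate n D \<phi> t y ! i = (if i \<in> D then y ! \<phi> i else t ! i)"
  by (simp add: recoordinate_def)

lemma vary_recoordinate:
  assumes "D \<subseteq> {..<n}" "\<phi> ` D \<subseteq> {..<m}"
  shows "vary n (recoordinate n D \<phi> t ` S) = {i \<in> D. \<phi> i \<in> vary m S}"
proof -
  have "i < n" "\<phi> i < m" if "i \<in> D" for i using assms that by auto
  then show ?thesis
    by (auto simp: vary_def nth_recoordinate split: if_splits) blast+
qed

text \<open>
  Because \<open>\<phi>\<close> is injective, the subcubes to be merged do not move apart.
\<close>

lemma cluster_recoordinate:
  assumes "cluster m S" and \<phi>: "inj_on \<phi> D" "D \<subseteq> {..<n}" "\<phi> ` D \<subseteq> {..<m}"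
  shows "cluster n (recoordinate n D \<phi> t ` S)"
  using assms(1)
proof (induction rule: cluster.induct)
  case (single x)
  then show ?case by (simp add: cluster.single)
next
  case (merge S T)
  let ?r = "recoordinate n D \<phi> t" and ?G = "vary m (S \<union> T) - vary m S - vary m T"
  have "cluster n (?r ` S \<union> ?r ` T)"
  proof (rule cluster_Un)
    have "vary n (?r ` S \<union> ?r ` T) - vary n (?r ` S) - vary n (?r ` T) = {i \<in> D. \<phi> i \<in> ?G}"
      unfolding image_Un[symmetric] vary_recoordinate[OF \<phi>(2,3)] by auto
    also have "card \<dots> \<le> card ?G"
      by (rule card_inj_on_le[of \<phi>]) (use \<phi>(1) in \<open>auto simp: inj_on_def\<close>)
    finally show "card (vary n (?r ` S \<union> ?r ` T) - vary n (?r ` S) - vary n (?r ` T)) \<le> 2"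
      using merge by simp
  qed (use merge in auto)
  then show ?case by (simp add: image_Un)
qed

lemma vary_insert_update:
  assumes "t \<in> X"
  shows "vary n (insert (t[j := c]) X) \<subseteq> insert j (vary n X)"
proof
  fix i assume i: "i \<in> vary n (insert (t[j := c]) X)"
  then obtain u w where uw: "u \<in> insert (t[j := c]) X" "w \<in> insert (t[j := c]) X" "u ! i \<noteq> w ! i"
    by (auto simp: vary_def)
  have "i \<in> vary n X" if "i \<noteq> j"
  proof -
    have t: "t[j := c] ! i = t ! i" using that by simp
    obtain u' where "u' \<in> X" "u' ! i = u ! i" using uw(1) t assms by auto
    moreover obtain w' where "w' \<in> X" "w' ! i = w ! i" using uw(2) t assms by auto
    ultimately show ?thesis
      using uw(3) eq_if_not_vary[of i n X u' w'] vary_less[OF i] by auto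
  qed
  then show "i \<in> insert j (vary n X)" by auto
qed

text \<open>
  Every added vertex is at distance at most one from a vertex of the cluster.
\<close>

lemma cluster_add_updates:
  assumes "finite J" "cluster n S" "t \<in> S"
  shows "cluster n (S \<union> (\<lambda>j. t[j := c]) ` J)"
  using assms(1)
proof induction
  case empty
  then show ?case using assms by simp
next
  case (insert j J)
  let ?X = "S \<union> (\<lambda>j. t[j := c]) ` J"
  have "card (vary n (insert (t[j := c]) ?X) - vary n ?X) \<le> card {j}"
    by (rule card_mono) (use vary_insert_update[of t ?X n j c] assms(3) in auto)
  then have "cluster n (insert (t[j := c]) ?X)"
    by (intro cluster_insert insert) simp
  then show ?case by simp
qed

text \<open>
  A subset of \<open>S\<close> that is non-constant in the same coordinates as \<open>S\<close> spans the same subcube, so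
  this is minimality among the clusters spanning a given subcube.
\<close>

definition minimal_cluster :: "nat \<Rightarrow> nat list set \<Rightarrow> bool" where
  "minimal_cluster n S \<longleftrightarrow> cluster n S \<and> (\<forall>R. R \<subset> S \<longrightarrow> cluster n R \<longrightarrow> vary n R \<noteq> vary n S)"

text \<open>
  The embedded copy of \<open>S\<close>, together with one extra vertex for each coordinate not in the range of
  \<open>\<phi>\<close>, has full hull and so contains a minimal hull set \<open>R\<close>. The extra vertices are shifts of one
  vertex of the copy, so the projection back maps \<open>R\<close> into \<open>S\<close>. Its image is a cluster spanning
  the subcube of \<open>S\<close>, and therefore all of \<open>S\<close> by minimality.
\<close>

lemma minimal_cluster_card_le_p_num:
  assumes S: "S \<subseteq> pverts (hamming rs)" "minimal_cluster (length rs) S"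
    and ss: "\<forall>r\<in>set ss. r > 1"
    and \<phi>: "inj_on \<phi> (vary (length rs) S)" "\<phi> ` vary (length rs) S \<subseteq> {..<length ss}"
    and le: "\<And>i. i \<in> vary (length rs) S \<Longrightarrow> rs ! i \<le> ss ! \<phi> i"
  shows "card S \<le> p_num (hamming ss)"
proof -
  let ?n = "length rs" and ?m = "length ss"
  let ?D = "vary ?n S"
  let ?E = "\<phi> ` ?D" and ?\<psi> = "inv_into ?D \<phi>"
  have D: "?D \<subseteq> {..<?n}" by (auto simp: vary_def)
  have cl: "cluster ?n S" using S by (simp add: minimal_cluster_def)
  then obtain t where t: "t \<in> S" using cluster_finite_nonempty by blast
  \<comment> \<open>\<open>e\<close> embeds \<open>S\<close>, putting 0 into the unused coordinates; \<open>g\<close> is its left inverse on \<open>S\<close>.\<close>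
  define e where "e = recoordinate ?m ?E ?\<psi> (replicate ?m 0)"
  define g where "g = recoordinate ?n ?D \<phi> t"
  define U where "U = e ` S \<union> (\<lambda>j. (e t)[j := 1]) ` ({..<?m} - ?E)"
  have \<psi>: "inj_on ?\<psi> ?E" "?\<psi> ` ?E = ?D"
    using \<phi>(1) by (auto simp: inj_on_inv_into image_iff)
  have ss_gt: "1 < ss ! j" if "j < ?m" for j using ss that by simp
  have len: "length x = ?n" if "x \<in> S" for x using that S by (auto simp: pverts_hamming)
  have ge: "g (e x) = x" if x: "x \<in> S" for x
  proof (rule nth_equalityI)
    show "length (g (e x)) = length x" using len x by (simp add: g_def)
    fix i assume "i < length (g (e x))"
    then have i: "i < ?n" by (simp add: g_def)
    show "g (e x) ! i = x ! i"
    proof (cases "i \<in> ?D")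
      case True
      then have "\<phi> i < ?m" using \<phi>(2) by auto
      then show ?thesis using True i \<phi>(1) by (simp add: g_def e_def nth_recoordinate)
    next
      case False
      then show ?thesis using i eq_if_not_vary[OF False i t x] by (simp add: g_def nth_recoordinate)
    qed
  qed
  have gt: "g ((e t)[j := 1]) = t" if "j \<notin> ?E" for j
  proof -
    have "j \<noteq> \<phi> i" if "i \<in> ?D" for i using that \<open>j \<notin> ?E\<close> by auto
    then have "g ((e t)[j := 1]) = g (e t)"
      by (simp add: g_def recoordinate_def)
    then show ?thesis using ge t by simp
  qed
  have eV: "e x \<in> pverts (hamming ss)" if x: "x \<in> S" for x
  proof -
    have "e x ! j < ss ! j" if j: "j < ?m" for j
    proof (cases "j \<in> ?E")
      case True
      then obtain i where i: "i \<in> ?D" "j = \<phi> i" by auto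
      have "x ! i < rs ! i" using x S i D by (auto simp: pverts_hamming)
      then show ?thesis using i le[of i] j \<phi>(1) by (simp add: e_def nth_recoordinate)
    next
      case False
      then show ?thesis using ss_gt[OF j] j by (simp add: e_def nth_recoordinate)
    qed
    then show ?thesis by (simp add: pverts_hamming e_def)
  qed
  have UV: "U \<subseteq> pverts (hamming ss)"
  proof -
    have "(e t)[j := 1] \<in> pverts (hamming ss)" if "j < ?m" for j
      using eV[OF t] ss_gt[OF that] that by (auto simp: pverts_hamming nth_list_update)
    then show ?thesis using eV by (auto simp: U_def)
  qed
  have ecl: "cluster ?m (e ` S)"
    unfolding e_def by (rule cluster_recoordinate[OF cl]) (use \<psi> \<phi> D in auto)
  have Ucl: "cluster ?m U"
    unfolding U_def by (rule cluster_add_updates[OF _ ecl]) (use t in auto)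
  have "j \<in> vary ?m U" if j: "j < ?m" for j
  proof (cases "j \<in> ?E")
    case True
    then have "?\<psi> j \<in> ?D" using \<psi>(2) by blast
    then have "j \<in> vary ?m (e ` S)"
      unfolding e_def using True vary_recoordinate[of ?E ?m ?\<psi> ?n] \<phi>(2) \<psi>(2) D by simp
    then show ?thesis using vary_mono[of "e ` S" U ?m] by (auto simp: U_def)
  next
    case False
    have "e t ! j = 0" "(e t)[j := 1] ! j = 1" using False j by (auto simp: e_def nth_recoordinate)
    moreover have "e t \<in> U" "(e t)[j := 1] \<in> U" using t False j by (auto simp: U_def)
    ultimately show ?thesis using j unfolding vary_def by force
  qed
  then have Uvary: "vary ?m U = {..<?m}" by (auto simp: vary_def)
  have "finite U" using UV finite_pverts_hamming finite_subset by blast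
  then obtain R where R: "R \<subseteq> U" "minimal_hull_set (hamming ss) R"
    using minimal_hull_set_exists[OF _ UV] hull_full_if_cluster[OF UV Ucl Uvary] by blast
  have finR: "finite R" using R \<open>finite U\<close> finite_subset by blast
  have Rcl: "cluster ?m R" "vary ?m R = {..<?m}"
    using cluster_if_hull_full[of R ss] R ss by (auto simp: minimal_hull_set_def)
  have "g ` R \<subseteq> S" using R(1) ge gt t by (auto simp: U_def)
  moreover have "cluster ?n (g ` R)"
    unfolding g_def by (rule cluster_recoordinate[OF Rcl(1) \<phi>(1) D \<phi>(2)])
  moreover have "vary ?n (g ` R) = ?D"
    unfolding g_def vary_recoordinate[OF D \<phi>(2)] Rcl(2) using \<phi>(2) by auto
  ultimately have "g ` R = S" using S(2) unfolding minimal_cluster_def by blast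
  then have "card S \<le> card R" using card_image_le[OF finR, of g] by simp
  also have "\<dots> \<le> p_num (hamming ss)" by (rule card_le_p_num[OF finite_pverts_hamming R(2)])
  finally show ?thesis .
qed

text \<open>
  In a descending list, moving an entry to the left can only lead to larger factors.
\<close>

lemma embed_into_largest_factors:
  assumes D: "D \<subseteq> {..<length rs}" "card D \<le> m"
  obtains \<phi> where "inj_on \<phi> D" "\<phi> ` D \<subseteq> {..<m}"
    "\<And>i. i \<in> D \<Longrightarrow> rs ! i \<le> take m (rev (sort rs)) ! \<phi> i"
proof -
  let ?xs = "rev (sort rs)" and ?n = "length rs"
  have "mset rs = mset ?xs" by simp
  then obtain \<pi> where \<pi>: "bij_betw \<pi> {..<?n} {..<?n}" "\<And>i. i < ?n \<Longrightarrow> rs ! i = ?xs ! \<pi> i"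
    using permutation_Ex_bij[of rs ?xs] by auto
  have fin: "finite D" using D finite_subset by blast
  have inj: "inj_on \<pi> D" using \<pi>(1) D by (auto simp: bij_betw_def intro: inj_on_subset)
  \<comment> \<open>Moving each position to its rank among the used ones shifts it to the left.\<close>
  define \<phi> where "\<phi> i = card {k \<in> D. \<pi> k < \<pi> i}" for i
  have lt: "\<phi> i < \<phi> j" if "i \<in> D" "j \<in> D" "\<pi> i < \<pi> j" for i j
    unfolding \<phi>_def by (rule psubset_card_mono) (use fin that in auto)
  show ?thesis
  proof
    show "inj_on \<phi> D"
    proof (rule inj_onI)
      fix i j assume ij: "i \<in> D" "j \<in> D" "\<phi> i = \<phi> j"
      then have "\<pi> i = \<pi> j" using lt[of i j] lt[of j i] by force
      then show "i = j" using ij inj by (auto simp: inj_on_def)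
    qed
    have less: "\<phi> i < m" if "i \<in> D" for i
    proof -
      have "\<phi> i < card D" unfolding \<phi>_def by (rule psubset_card_mono) (use fin that in auto)
      then show ?thesis using D by simp
    qed
    then show "\<phi> ` D \<subseteq> {..<m}" by auto
    fix i assume i: "i \<in> D"
    have "\<phi> i = card (\<pi> ` {k \<in> D. \<pi> k < \<pi> i})"
      unfolding \<phi>_def by (rule card_image[symmetric], rule inj_on_subset[OF inj]) auto
    also have "\<dots> \<le> card {..<\<pi> i}" by (rule card_mono) auto
    finally have "\<phi> i \<le> \<pi> i" by simp
    moreover have "\<pi> i < ?n" using \<pi>(1) i D by (auto simp: bij_betw_def)
    moreover have "sorted_wrt (\<ge>) ?xs" by (simp add: sorted_wrt_rev)
    ultimately have "?xs ! \<pi> i \<le> ?xs ! \<phi> i"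
      by (cases "\<phi> i = \<pi> i") (auto simp: sorted_wrt_iff_nth_less)
    then show "rs ! i \<le> take m ?xs ! \<phi> i" using \<pi>(2) i D less by auto
  qed
qed

lemma minimal_cluster_card_le_prefix:
  assumes rs: "\<forall>r\<in>set rs. r > 1" and S: "S \<subseteq> pverts (hamming rs)" "minimal_cluster (length rs) S"
    and m: "card (vary (length rs) S) \<le> m" "m \<le> length rs"
  shows "card S \<le> p_num (hamming_prefix m rs)"
proof -
  have "vary (length rs) S \<subseteq> {..<length rs}" by (auto simp: vary_def)
  then obtain \<phi> where \<phi>: "inj_on \<phi> (vary (length rs) S)" "\<phi> ` vary (length rs) S \<subseteq> {..<m}"
    "\<And>i. i \<in> vary (length rs) S \<Longrightarrow> rs ! i \<le> take m (rev (sort rs)) ! \<phi> i"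
    using embed_into_largest_factors m(1) by metis
  show ?thesis
    unfolding hamming_prefix_def
  proof (rule minimal_cluster_card_le_p_num[OF S _ \<phi>(1) _ \<phi>(3)])
    show "\<forall>r\<in>set (take m (rev (sort rs))). r > 1"
      using rs by (auto dest: in_set_takeD)
    show "\<phi> ` vary (length rs) S \<subseteq> {..<length (take m (rev (sort rs)))}"
      using \<phi>(2) m(2) by simp
  qed
qed

section \<open>The last merger of a minimal hull set\<close>

text \<open>
  A proper subset \<open>R\<close> of \<open>T\<close> spanning the same subcube would regenerate all of \<open>T\<close>, so the smaller
  set \<open>R \<union> (S - T)\<close> would have full hull as well.
\<close>

lemma subcluster_minimal:
  assumes S: "minimal_hull_set (hamming rs) S" and T: "T \<subseteq> S" "cluster (length rs) T"
  shows "minimal_cluster (length rs) T"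
  unfolding minimal_cluster_def
proof (intro conjI allI impI notI)
  fix R assume R: "R \<subset> T" "cluster (length rs) R" "vary (length rs) R = vary (length rs) T"
  let ?R = "R \<union> (S - T)"
  have SV: "S \<subseteq> pverts (hamming rs)" and full: "P3_hull (hamming rs) S = pverts (hamming rs)"
    using S by (auto simp: minimal_hull_set_def)
  have RV: "?R \<subseteq> pverts (hamming rs)" using R T SV by auto
  note hull = P3_hull_least[OF pair_graph_hamming RV]
  obtain r where r: "r \<in> R" using R(2) cluster_finite_nonempty by blast
  have "cube rs r (vary (length rs) R) \<subseteq> P3_hull (hamming rs) ?R"
    by (rule cluster_cube_subset_convex) (use R hull r in auto)
  moreover have "T \<subseteq> cube rs r (vary (length rs) R)"
  proof
    fix x assume "x \<in> T"
    then show "x \<in> cube rs r (vary (length rs) R)"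
      using eq_if_not_vary[of _ "length rs" T x r] r R(1) SV T(1) by (auto simp: cube_def R(3))
  qed
  ultimately have "S \<subseteq> P3_hull (hamming rs) ?R" using hull(2) by auto
  then have "P3_hull (hamming rs) S \<subseteq> P3_hull (hamming rs) ?R"
    using P3_hull_least(3)[OF pair_graph_hamming SV] hull(1) by auto
  moreover have "?R \<subset> S" using R(1) T(1) by auto
  then have "P3_hull (hamming rs) ?R \<subset> pverts (hamming rs)"
    by (rule minimal_hull_set_proper_subset[OF S])
  ultimately show False using full by simp
qed (use T in auto)

text \<open>
  The subcube of \<open>T\<close> fixes at most two coordinates, so every vertex is within distance two of it and
  can be merged. Choosing vertices of \<open>S\<close> that free a fixed coordinate, at most two are required to
  reach the full hull. Counting \<open>S\<close> from the cluster just before the last of them, rather than from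
  \<open>T\<close>, leaves a single vertex to account for.
\<close>

lemma card_le_Suc_if_large_subcluster:
  assumes rs: "\<forall>r\<in>set rs. r > 1" and S: "minimal_hull_set (hamming rs) S"
    and T: "T \<subset> S" "cluster (length rs) T" and large: "length rs \<le> card (vary (length rs) T) + 2"
  shows "card S \<le> p_num (hamming_prefix (length rs - 1) rs) + 1"
proof -
  let ?n = "length rs"
  have SV: "S \<subseteq> pverts (hamming rs)" and full: "P3_hull (hamming rs) S = pverts (hamming rs)"
    using S by (auto simp: minimal_hull_set_def)
  have least: "P3_hull (hamming rs) R \<noteq> pverts (hamming rs)" if "R \<subset> S" for R
    using minimal_hull_set_proper_subset[OF S that] by simp
  have sub: "vary ?n X \<subseteq> {..<?n}" for X by (auto simp: vary_def)
  have not_full: "vary ?n X \<noteq> {..<?n}" if "X \<subset> S" "cluster ?n X" for X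
    using least[OF that(1)] hull_full_if_cluster[OF _ that(2)] that(1) SV by blast
  have missing: "\<exists>j<?n. j \<notin> vary ?n X" if "X \<subset> S" "cluster ?n X" for X
    using not_full[OF that] sub[of X] by auto
  have extend: "\<exists>w\<in>S. j \<in> vary ?n (insert w X)" if j: "j < ?n" and X: "X \<noteq> {}" for j X
  proof -
    have "j \<in> vary ?n S" using cluster_if_hull_full[OF SV full rs] j by simp
    then obtain u w where "u \<in> S" "w \<in> S" "u ! j \<noteq> w ! j" by (auto simp: vary_def)
    moreover obtain x where "x \<in> X" using X by auto
    ultimately show ?thesis using j by (cases "u ! j = x ! j") (auto simp: vary_def)
  qed
  have insert_cluster: "cluster ?n (insert w X)" if "cluster ?n X" "T \<subseteq> X" for w X
  proof (rule cluster_insert[OF that(1)])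
    have "card (vary ?n (insert w X) - vary ?n X) \<le> card ({..<?n} - vary ?n T)"
      by (rule card_mono) (use vary_mono[OF that(2), of ?n] sub in auto)
    also have "\<dots> = ?n - card (vary ?n T)" using sub by (simp add: card_Diff_subset)
    also have "\<dots> \<le> 2" using large by simp
    finally show "card (vary ?n (insert w X) - vary ?n X) \<le> 2" .
  qed
  have conclude: ?thesis
    if X: "X \<subset> S" "T \<subseteq> X" "cluster ?n X" and w: "w \<in> S" "vary ?n (insert w X) = {..<?n}" for X w
  proof -
    have "insert w X = S"
      using not_full[OF _ insert_cluster[OF X(3,2), of w]] w X(1) by blast
    moreover have "finite X" using X(3) cluster_finite_nonempty by auto
    ultimately have "card S \<le> card X + 1" using card_insert_le_m1[of "Suc (card X)" X w] by auto
    moreover have "card (vary ?n X) < card {..<?n}"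
      by (rule psubset_card_mono) (use sub not_full X in auto)
    then have "card X \<le> p_num (hamming_prefix (?n - 1) rs)"
      by (intro minimal_cluster_card_le_prefix rs subcluster_minimal[OF S]) (use X SV in auto)
    ultimately show ?thesis by simp
  qed
  obtain j where j: "j < ?n" "j \<notin> vary ?n T" using missing T by blast
  obtain w where w: "w \<in> S" "j \<in> vary ?n (insert w T)"
    using extend[OF j(1), of T] T(2) cluster_finite_nonempty by blast
  show ?thesis
  proof (cases "vary ?n (insert w T) = {..<?n}")
    case True
    then show ?thesis using conclude[OF T(1) _ T(2) w(1)] by simp
  next
    case False
    let ?X = "insert w T"
    have X: "cluster ?n ?X" by (rule insert_cluster) (use T in auto)
    have "?X \<noteq> S" using False cluster_if_hull_full[OF SV full rs] by auto
    then have XS: "?X \<subset> S" using w T by auto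
    obtain k where k: "k < ?n" "k \<notin> vary ?n ?X" using missing[OF XS X] by blast
    obtain w' where w': "w' \<in> S" "k \<in> vary ?n (insert w' ?X)"
      using extend[OF k(1), of ?X] by blast
    have mono: "vary ?n T \<subseteq> vary ?n ?X" "vary ?n ?X \<subseteq> vary ?n (insert w' ?X)"
      by (rule vary_mono; auto)+
    have "j \<noteq> k" "j \<notin> vary ?n T" "k \<notin> vary ?n T" using j k w mono by auto
    then have "card (insert j (insert k (vary ?n T))) = card (vary ?n T) + 2" by simp
    moreover have "insert j (insert k (vary ?n T)) \<subseteq> vary ?n (insert w' ?X)"
      using mono w w' by auto
    ultimately have "card {..<?n} \<le> card (vary ?n (insert w' ?X))"
      using large card_mono[OF finite_vary] by (metis card_lessThan le_trans)
    then have "vary ?n (insert w' ?X) = {..<?n}"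
      using sub by (intro card_seteq) auto
    then show ?thesis using conclude[OF XS _ X w'(1)] by auto
  qed
qed

lemma card_minimal_hull_set_le:
  assumes rs: "\<forall>r\<in>set rs. r > 1" and S: "minimal_hull_set (hamming rs) S"
  shows "card S \<le> max (2 * p_num (hamming_prefix (length rs - 3) rs))
    (p_num (hamming_prefix (length rs - 1) rs) + 1)"
proof -
  let ?n = "length rs"
  have SV: "S \<subseteq> pverts (hamming rs)" and full: "P3_hull (hamming rs) S = pverts (hamming rs)"
    using S by (auto simp: minimal_hull_set_def)
  have "cluster ?n S" by (rule cluster_if_hull_full(1)[OF SV full rs])
  then show ?thesis
  proof cases
    case (single x)
    then show ?thesis by simp
  next
    case (merge A B)
    have AB: "A \<subset> S" "B \<subset> S" using merge by auto
    show ?thesis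
    proof (cases "?n \<le> card (vary ?n A) + 2 \<or> ?n \<le> card (vary ?n B) + 2")
      case True
      then have "card S \<le> p_num (hamming_prefix (?n - 1) rs) + 1"
        using card_le_Suc_if_large_subcluster[OF rs S AB(1) merge(2)]
          card_le_Suc_if_large_subcluster[OF rs S AB(2) merge(3)] by argo
      then show ?thesis by simp
    next
      case False
      have small: "card X \<le> p_num (hamming_prefix (?n - 3) rs)"
        if "X \<subset> S" "cluster ?n X" "\<not> ?n \<le> card (vary ?n X) + 2" for X
      proof (rule minimal_cluster_card_le_prefix[OF rs])
        show "X \<subseteq> pverts (hamming rs)" using that(1) SV by blast
        show "minimal_cluster ?n X"
          by (rule subcluster_minimal[OF S _ that(2)]) (use that(1) in blast)
        show "card (vary ?n X) \<le> ?n - 3" using that(3) by linarith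
      qed simp
      have "card S \<le> card A + card B" unfolding merge(1) by (rule card_Un_le)
      also have "\<dots> \<le> 2 * p_num (hamming_prefix (?n - 3) rs)"
        using small[OF AB(1) merge(2)] small[OF AB(2) merge(3)] False by simp
      finally show ?thesis by simp
    qed
  qed
qed

theorem lemma3p1:
  fixes G :: "'a pair_pre_digraph" and rs :: "nat list" and n :: nat
  assumes "n \<ge> 4"
    and "length rs = n"
    and "\<forall>r \<in> set rs. r > 1"
    and "digraph_iso (with_proj G) (with_proj (hamming rs))"
  shows "p_num G \<le> max (2 * p_num (hamming_prefix (n - 3) rs)) (p_num (hamming_prefix (n - 1) rs) + 1)"
proof -
  have "p_num G \<le> p_num (hamming rs)"
    by (rule p_num_iso_le[OF assms(4) finite_pverts_hamming])
  moreover obtain S where "minimal_hull_set (hamming rs) S" "p_num (hamming rs) = card S"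
    by (rule p_num_attained[OF finite_pverts_hamming])
  ultimately show ?thesis
    using card_minimal_hull_set_le[OF assms(3), of S] unfolding assms(2) by simp
qed

end
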